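(* The function $\mathrm{enc}$ from formulas of propositional logic to $\mathbb{N}$ defined recursively by $$\mathrm{enc}(p_n)=\pi(0,n+1),\quad \mathrm{enc}(\bot)=0,\quad \mathrm{enc}(\varphi\wedge\psi)=\pi(\pi(\mathrm{enc}(\varphi),1),\mathrm{enc}(\psi)),$$ $$\mathrm{enc}(\varphi\vee\psi)=\pi(\pi(\mathrm{enc}(\varphi),2),\mathrm{enc}(\psi)),\quad \mathrm{enc}(\varphi\to\psi)=\pi(\pi(\mathrm{enc}(\varphi),3),\mathrm{enc}(\psi)),$$ where $\pi(x,y)=(x+y)(x+y+1)+2x$ for $x,y\in\mathbb{N}$, is injective. Consequently the set of formulas is countable.
   Context: Formulas are built freely (as an inductive type) from propositional variables $p_n$ ($n\in\mathbb{N}$, with $p_n\ne p_m$ for $n\neq m$) and $\bot$ by the binary connectives $\wedge,\vee,\to$. $\mathbb{N}$ includes $0$. A set is countable if it admits an injection into $\mathbb{N}$. *)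

theory Defs
  imports Main "HOL-Library.Countable_Set"
begin

datatype formula =
    Var nat
  | Bot
  | And formula formula
  | Or formula formula
  | Imp formula formula

text \<open>This is twice the Cantor pairing function, so it is not the library's
  \<^verbatim>\<open>prod_encode\<close>.\<close>

definition pair :: "nat \<Rightarrow> nat \<Rightarrow> nat" where
  "pair x y = (x + y) * (x + y + 1) + 2 * x"

primrec enc :: "formula \<Rightarrow> nat" where
  "enc (Var n) = pair 0 (n + 1)"
| "enc Bot = 0"
| "enc (And \<phi> \<psi>) = pair (pair (enc \<phi>) 1) (enc \<psi>)"
| "enc (Or \<phi> \<psi>) = pair (pair (enc \<phi>) 2) (enc \<psi>)"
| "enc (Imp \<phi> \<psi>) = pair (pair (enc \<phi>) 3) (enc \<psi>)"

end

theory Submission imports Defs "HOL-Library.Nat_Bijection" begin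

text \<open>\<open>pair\<close> doubles the Cantor pairing, so it is injective. The first component
  of a code is 0 for a variable and a pair with tag 1, 2 or 3 for a connective. Thus a code
  determines the outermost constructor and the codes of its parts, and induction recovers the
  formula.\<close>

lemma pair_eq_prod_encode: "pair x y = 2 * prod_encode (x, y)"
proof -
  have "2 * triangle n = n * (n + 1)" for n
    by (simp add: triangle_def)
  then show ?thesis
    by (simp add: pair_def prod_encode_def distrib_left)
qed

lemma pair_eq_iff [simp]: "pair x y = pair x' y' \<longleftrightarrow> x = x' \<and> y = y'"
  by (simp add: pair_eq_prod_encode)

text \<open>Separates constructors: tags and n + 1 are positive, so these pairs never equal
  0.\<close>

lemma pair_eq_0_iff [simp]: "pair x y = 0 \<longleftrightarrow> x = 0 \<and> y = 0"
  by (auto simp: pair_def)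

lemma enc_eq_imp_eq: "enc \<phi> = enc \<psi> \<Longrightarrow> \<phi> = \<psi>"
proof (induction \<phi> arbitrary: \<psi>)
  case (Var n)
  \<comment> \<open>Connectives leave \<open>0 = pair _ _\<close>; \<open>sym\<close> turns it round
    for \<open>pair_eq_0_iff\<close>.\<close>
  then show ?case by (cases \<psi>) (auto dest: sym)
next
  case Bot
  then show ?case by (cases \<psi>) (auto dest: sym)
next
  case (And \<phi>1 \<phi>2)
  then show ?case by (cases \<psi>) auto
next
  case (Or \<phi>1 \<phi>2)
  then show ?case by (cases \<psi>) auto
next
  case (Imp \<phi>1 \<phi>2)
  then show ?case by (cases \<psi>) auto
qed

theorem mainTheorem4: "inj enc \<and> countable (UNIV :: formula set)"
proof
  show "inj enc"
    by (rule injI) (rule enc_eq_imp_eq)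
  then show "countable (UNIV :: formula set)"
    by (rule countableI)
qed

end
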